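(* Let $\kappa,\mu_1,\mu_2,\lambda$ be cardinals with $\aleph_0 < \kappa < 2^\kappa \leq \mu_1 \leq \mu_2 < \lambda = \lambda^\kappa$, and suppose $\kappa$ is measurable. Then there exists a regular uniform ultrafilter $D$ on $\lambda$ such that $D$ is $\lambda$-flexible, thus $\lambda$-OK, but $D$ is not $(2^\kappa)^+$-good. In particular, $D$ is $(\mu_2)^+$-OK but not $(\mu_1)^+$-good.
   Context: For a cardinal $\mu$, $[\mu]^{<\aleph_0}$ denotes the set of finite subsets of $\mu$. For $f:[\mu]^{<\aleph_0}\to D$, a multiplicative refinement of $f$ is a $g:[\mu]^{<\aleph_0}\to D$ with $g(u)\subseteq f(u)$ and $g(u)\cap g(v)=g(u\cup v)$ for all $u,v$. $f$ is monotone if $u\subseteq v$ implies $f(u)\supseteq f(v)$. A filter $D$ on a set $I$ with $|I|=\lambda$ is regular if there are $X_i \in D$ ($i<\lambda$) such that each $t\in I$ belongs to only finitely many $X_i$. An ultrafilter on an infinite set $I$ is uniform if all its members have cardinality $|I|$. A filter $D$ on $I$ is $\mu^+$-good if every $f:[\mu]^{<\aleph_0}\to D$ has a multiplicative refinement (one may restrict to monotone $f$). A filter $D$ on $I$ is $\mu$-OK if every monotone $f:[\mu]^{<\aleph_0}\to D$ such that $f(u)=f(v)$ whenever $|u|=|v|$ has a multiplicative refinement. A filter $D$ on $I$ is $\lambda$-flexible if for every $f: I \to \mathbb{N}$ such that $\{t\in I : f(t)>n\}\in D$ for all $n \in \mathbb{N}$, there are $X_\alpha \in D$ ($\alpha<\lambda$)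 with $|\{\alpha<\lambda : t\in X_\alpha\}| \le f(t)$ for all $t\in I$. An uncountable cardinal $\kappa$ is measurable if there is a $\kappa$-complete nonprincipal ultrafilter on $\kappa$. *)

theory Defs
  imports Main
begin

unbundle cardinal_syntax

text \<open>
  Cardinals are rendered as in the library: a cardinal is a relation \<open>r\<close> with \<open>Card_order r\<close>, and
  the set of ordinals below it is \<open>Field r\<close>. A cardinal that carries a filter is taken with
  \<open>card_order r\<close>, so that its field is the whole underlying type and filters on it are
  elements of the library type of filters over that type.
\<close>

definition filter_sets :: "'a filter \<Rightarrow> 'a set set" where
  "filter_sets D = {X. eventually (\<lambda>t. t \<in> X) D}"

text \<open>The library filter \<open>bot\<close> contains the empty set, so an ultrafilter must differ from it.\<close>

definition ultrafilter :: "'a filter \<Rightarrow> bool" where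
  "ultrafilter D \<longleftrightarrow> D \<noteq> bot \<and> (\<forall>X. X \<in> filter_sets D \<or> - X \<in> filter_sets D)"

text \<open>The index set of the regularizing family is the underlying set itself, which has the
  required cardinality.\<close>

definition regular_filter :: "'a filter \<Rightarrow> bool" where
  "regular_filter D \<longleftrightarrow>
     (\<exists>X :: 'a \<Rightarrow> 'a set. (\<forall>i. X i \<in> filter_sets D) \<and> (\<forall>t. finite {i. t \<in> X i}))"

definition uniform_filter :: "'a filter \<Rightarrow> bool" where
  "uniform_filter D \<longleftrightarrow> (\<forall>X \<in> filter_sets D. |X| =o |UNIV :: 'a set| )"

definition multiplicative_refinement ::
  "'a filter \<Rightarrow> 'b rel \<Rightarrow> ('b set \<Rightarrow> 'a set) \<Rightarrow> ('b set \<Rightarrow> 'a set) \<Rightarrow> bool" where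
  "multiplicative_refinement D \<mu> f g \<longleftrightarrow>
     (\<forall>u \<in> Fpow (Field \<mu>). g u \<in> filter_sets D \<and> g u \<subseteq> f u) \<and>
     (\<forall>u \<in> Fpow (Field \<mu>). \<forall>v \<in> Fpow (Field \<mu>). g u \<inter> g v = g (u \<union> v))"

text \<open>\<open>succ_good \<mu> D\<close> says that \<open>D\<close> is \<open>\<mu>\<^sup>+\<close>-good: the parameter is \<open>\<mu>\<close>, not its successor.
  In contrast, \<open>OK \<mu> D\<close> says that \<open>D\<close> is \<open>\<mu>\<close>-OK.\<close>

definition succ_good :: "'b rel \<Rightarrow> 'a filter \<Rightarrow> bool" where
  "succ_good \<mu> D \<longleftrightarrow>
     (\<forall>f :: 'b set \<Rightarrow> 'a set. (\<forall>u \<in> Fpow (Field \<mu>). f u \<in> filter_sets D) \<longrightarrow>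
        (\<exists>g. multiplicative_refinement D \<mu> f g))"

definition OK :: "'b rel \<Rightarrow> 'a filter \<Rightarrow> bool" where
  "OK \<mu> D \<longleftrightarrow>
     (\<forall>f :: 'b set \<Rightarrow> 'a set.
        (\<forall>u \<in> Fpow (Field \<mu>). f u \<in> filter_sets D) \<longrightarrow>
        antimono_on (Fpow (Field \<mu>)) f \<longrightarrow>
        (\<forall>u \<in> Fpow (Field \<mu>). \<forall>v \<in> Fpow (Field \<mu>). card u = card v \<longrightarrow> f u = f v) \<longrightarrow>
        (\<exists>g. multiplicative_refinement D \<mu> f g))"

definition flexible :: "'b rel \<Rightarrow> 'a filter \<Rightarrow> bool" where
  "flexible \<mu> D \<longleftrightarrow>
     (\<forall>f :: 'a \<Rightarrow> nat. (\<forall>n. {t. f t > n} \<in> filter_sets D) \<longrightarrow>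
        (\<exists>X :: 'b \<Rightarrow> 'a set. (\<forall>\<alpha> \<in> Field \<mu>. X \<alpha> \<in> filter_sets D) \<and>
           (\<forall>t. finite {\<alpha> \<in> Field \<mu>. t \<in> X \<alpha>} \<and> card {\<alpha> \<in> Field \<mu>. t \<in> X \<alpha>} \<le> f t)))"

definition complete_filter :: "'b rel \<Rightarrow> 'a filter \<Rightarrow> bool" where
  "complete_filter \<kappa> D \<longleftrightarrow> (\<forall>\<A> \<subseteq> filter_sets D. |\<A>| <o \<kappa> \<longrightarrow> \<Inter>\<A> \<in> filter_sets D)"

definition measurable_cardinal :: "'a rel \<Rightarrow> bool" where
  "measurable_cardinal \<kappa> \<longleftrightarrow> card_order \<kappa> \<and> natLeq <o \<kappa> \<and>
     (\<exists>U :: 'a filter. ultrafilter U \<and> complete_filter \<kappa> U \<and> (\<nexists>A. U = principal A))"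

end

theory Submission
  imports Defs "HOL-Library.Extended_Nat"
begin

text \<open>
The ultrafilter is a Fubini product: \<open>E\<close> is a \<open>\<kappa>\<close>-complete nonprincipal ultrafilter on \<open>\<kappa>\<close>, \<open>D1\<close> is
a regular flexible ultrafilter on \<open>\<lambda>\<close>, and a set \<open>Z \<subseteq> \<kappa> \<times> \<lambda>\<close> is large when \<open>E\<close>-almost all its sections
are in \<open>D1\<close>. Since \<open>\<kappa> \<le> \<lambda>\<close>, the product can be moved to \<open>\<lambda>\<close>.

Positive properties are inherited from \<open>D1\<close>. Regularity is immediate, and flexibility can be checked
section by section, since countable completeness of \<open>E\<close> makes almost every section of an
unbounded function unbounded (\<open>flexible_filtermap_fubini_product\<close>). Regularity implies uniformity,
and together with flexibility it implies being OK (\<open>flexible_imp_OK\<close>).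

The failure of goodness comes from \<open>E\<close>. The \<open>2\<^sup>\<kappa>\<close> subsets of \<open>\<kappa>\<close>, viewed as functions
\<open>k \<mapsto> A \<inter> k\<close>, are pairwise distinct modulo \<open>E\<close>, and their distinctness on finite sets of indices is a
map into the product filter. A multiplicative refinement would choose for every \<open>A\<close> a coordinate \<open>k\<close>
such that subsets with the same \<open>k\<close> have distinct traces on \<open>k\<close>. As \<open>\<kappa>\<close> is a strong limit, there is
room for only \<open>\<kappa>\<close> subsets (\<open>not_succ_good_filtermap_fubini_product\<close>). Sections over a fixed \<open>k\<close>
always intersect, so the size of \<open>\<lambda>\<close> is of no help to the refinement.

The remaining task is to find \<open>D1\<close> (\<open>regular_flexible_ultrafilter_exists\<close>). This follows Kunen's
method of independent functions. Start with \<open>2\<^sup>\<lambda>\<close> functions from \<open>\<lambda>\<close> to finite subsets of \<open>\<lambda>\<close> that are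
independent, and run through all \<open>2\<^sup>\<lambda>\<close> bounds \<open>N\<close> on \<open>\<lambda>\<close>, enlarging the filter at each step while
keeping all but finitely many of the remaining functions independent over it: either some
\<open>{t. N t \<le> n}\<close> is added, or one of the functions is used to define sets \<open>X\<^sub>\<alpha>\<close> such that \<open>t\<close> lies in at
most \<open>N t\<close> of them (\<open>settle_one_bound\<close>). Every ultrafilter extending the final filter is flexible, so
membership of arbitrary sets never has to be decided along the way.
\<close>

section \<open>Ultrafilters from the finite intersection property\<close>

definition finite_intersection_property :: "'a set set \<Rightarrow> bool" where
  "finite_intersection_property G \<longleftrightarrow> (\<forall>\<A>\<subseteq>G. finite \<A> \<longrightarrow> \<Inter>\<A> \<noteq> {})"

lemma fip_chain_Union:
  assumes ch: "subset.chain {G. finite_intersection_property G} \<C>" and ne: "\<C> \<noteq> {}"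
  shows "finite_intersection_property (\<Union>\<C>)"
  unfolding finite_intersection_property_def
proof (intro allI impI)
  fix \<A> assume "\<A> \<subseteq> \<Union>\<C>" "finite \<A>"
  then obtain G where "G \<in> \<C>" "\<A> \<subseteq> G"
    using finite_subset_Union_chain[OF _ _ ne ch] by metis
  moreover have "finite_intersection_property G" using ch \<open>G \<in> \<C>\<close> unfolding subset.chain_def by auto
  ultimately show "\<Inter>\<A> \<noteq> {}" using \<open>finite \<A>\<close> unfolding finite_intersection_property_def by auto
qed

text \<open>
A maximal family with the finite intersection property contains every set
that meets all its finite intersections; upward closure, closure under intersection and the
ultrafilter dichotomy are all instances of this.
\<close>

lemma fip_maximal_insert:
  assumes M: "finite_intersection_property M"
    and max: "\<And>G. finite_intersection_property G \<Longrightarrow> M \<subseteq> G \<Longrightarrow> G = M"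
    and hit: "\<And>\<A>. \<A> \<subseteq> M \<Longrightarrow> finite \<A> \<Longrightarrow> \<Inter>\<A> \<inter> X \<noteq> {}"
  shows "X \<in> M"
proof -
  have "finite_intersection_property (insert X M)"
    unfolding finite_intersection_property_def
  proof (intro allI impI)
    fix \<A> assume "\<A> \<subseteq> insert X M" "finite \<A>"
    then have "\<Inter>(\<A> - {X}) \<inter> X \<noteq> {}" by (intro hit) auto
    then show "\<Inter>\<A> \<noteq> {}" by blast
  qed
  then show ?thesis using max by blast
qed

lemma ultrafilter_extending_fip:
  assumes "finite_intersection_property (G :: 'a set set)"
  shows "\<exists>U. ultrafilter U \<and> G \<subseteq> filter_sets U"
proof -
  define \<F> where "\<F> = {H. finite_intersection_property H \<and> G \<subseteq> H}"
  have "\<exists>M\<in>\<F>. \<forall>H\<in>\<F>. M \<subseteq> H \<longrightarrow> H = M"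
  proof (rule subset_Zorn_nonempty)
    show "\<F> \<noteq> {}" using assms unfolding \<F>_def by auto
    fix \<C> assume ne: "\<C> \<noteq> {}" and ch: "subset.chain \<F> \<C>"
    have "subset.chain {H. finite_intersection_property H} \<C>"
      using ch unfolding subset.chain_def \<F>_def by auto
    then have "finite_intersection_property (\<Union>\<C>)" using fip_chain_Union ne by blast
    moreover have "G \<subseteq> \<Union>\<C>" using ch ne unfolding \<F>_def subset.chain_def by blast
    ultimately show "\<Union>\<C> \<in> \<F>" unfolding \<F>_def by simp
  qed
  then obtain M where M: "finite_intersection_property M" and GM: "G \<subseteq> M"
    and "\<And>H. finite_intersection_property H \<Longrightarrow> G \<subseteq> H \<Longrightarrow> M \<subseteq> H \<Longrightarrow> H = M"
    unfolding \<F>_def by auto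
  then have max: "\<And>H. finite_intersection_property H \<Longrightarrow> M \<subseteq> H \<Longrightarrow> H = M" by blast
  note ins = fip_maximal_insert[OF M max]
  have fipD: "\<And>\<A>. \<A> \<subseteq> M \<Longrightarrow> finite \<A> \<Longrightarrow> \<Inter>\<A> \<noteq> {}"
    using M unfolding finite_intersection_property_def by auto
  have sup: "Y \<in> M" if "\<B> \<subseteq> M" "finite \<B>" "\<Inter>\<B> \<subseteq> Y" for \<B> Y
  proof (rule ins)
    fix \<A> assume "\<A> \<subseteq> M" "finite \<A>"
    then have "\<Inter>(\<A> \<union> \<B>) \<noteq> {}" using that by (intro fipD) auto
    then show "\<Inter>\<A> \<inter> Y \<noteq> {}" using that by (auto simp: Inter_Un_distrib)
  qed auto
  have filt: "is_filter (\<lambda>P. {t. P t} \<in> M)"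
  proof
    show "{t. True} \<in> M" using sup[of "{}" "{t. True}"] by simp
    show "{t. P t \<and> Q t} \<in> M" if "{t. P t} \<in> M" "{t. Q t} \<in> M" for P Q
      using sup[of "{{t. P t}, {t. Q t}}" "{t. P t \<and> Q t}"] that by auto
    show "{t. Q t} \<in> M" if "\<forall>t. P t \<longrightarrow> Q t" "{t. P t} \<in> M" for P Q
      using sup[of "{{t. P t}}" "{t. Q t}"] that by auto
  qed
  define U where "U = Abs_filter (\<lambda>P. {t. P t} \<in> M)"
  have U: "filter_sets U = M"
    unfolding filter_sets_def U_def eventually_Abs_filter[OF filt] by simp
  have "{} \<notin> M" using fipD[of "{{}}"] by auto
  then have "U \<noteq> bot" using U unfolding filter_sets_def by auto
  moreover have "X \<in> M \<or> - X \<in> M" for X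
  proof (rule disjCI)
    assume "- X \<notin> M"
    show "X \<in> M"
    proof (rule ins)
      fix \<A> assume "\<A> \<subseteq> M" "finite \<A>"
      then have "\<not> \<Inter>\<A> \<subseteq> - X" using sup \<open>- X \<notin> M\<close> by blast
      then show "\<Inter>\<A> \<inter> X \<noteq> {}" by auto
    qed auto
  qed
  ultimately show ?thesis using U GM unfolding ultrafilter_def by auto
qed

section \<open>Independent families of functions\<close>

text \<open>
The functions \<open>f i\<close> with \<open>i \<in> F\<close> can take any finitely many prescribed values simultaneously on
every finite intersection of members of \<open>G\<close>: no set of the filter generated by \<open>G\<close> constrains them.
\<close>

definition independent_over :: "('i \<Rightarrow> 'a \<Rightarrow> 'b) \<Rightarrow> 'i set \<Rightarrow> 'a set set \<Rightarrow> bool" where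
  "independent_over f F G \<longleftrightarrow>
     (\<forall>\<A>\<subseteq>G. \<forall>S\<subseteq>F. \<forall>v. finite \<A> \<longrightarrow> finite S \<longrightarrow> (\<exists>t\<in>\<Inter>\<A>. \<forall>i\<in>S. f i t = v i))"

lemma independent_overD:
  assumes "independent_over f F G" "\<A> \<subseteq> G" "S \<subseteq> F" "finite \<A>" "finite S"
  shows "\<exists>t\<in>\<Inter>\<A>. \<forall>i\<in>S. f i t = v i"
  by (rule assms(1)[unfolded independent_over_def, rule_format, OF assms(2-5)])

lemma not_independent_over:
  "\<not> independent_over f F G \<longleftrightarrow>
     (\<exists>\<A>\<subseteq>G. \<exists>S\<subseteq>F. \<exists>v. finite \<A> \<and> finite S \<and> \<not> (\<exists>t\<in>\<Inter>\<A>. \<forall>i\<in>S. f i t = v i))"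
  unfolding independent_over_def by (simp only: not_all not_imp)

section \<open>Settling all bounds\<close>

text \<open>
What a flexible filter owes to a bound \<open>N\<close>: either \<open>N\<close> is bounded by a standard number on a
set of \<open>H\<close>, or there are sets indexed by all of \<open>'b\<close> in \<open>H\<close> such that \<open>t\<close> lies in at most
\<open>N t\<close> of them. Here \<open>u t\<close> is the set of indices of the sets that contain \<open>t\<close>. Being a disjunction
rather than an implication whose hypothesis is that all \<open>{t. N t > n}\<close> are large, the condition
persists under enlarging \<open>H\<close>. The value \<open>\<infinity>\<close> is admitted because the constant bound \<open>\<infinity>\<close> then expresses regularity.
\<close>

definition settles :: "'b itself \<Rightarrow> ('a \<Rightarrow> enat) \<Rightarrow> 'a set set \<Rightarrow> bool" where
  "settles _ N H \<longleftrightarrow>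
     (\<exists>n::nat. {t. N t \<le> enat n} \<in> H) \<or>
     (\<exists>u :: 'a \<Rightarrow> 'b set. (\<forall>t. finite (u t) \<and> enat (card (u t)) \<le> N t) \<and> (\<forall>a. {t. a \<in> u t} \<in> H))"

text \<open>
If some \<open>{t. N t \<le> n}\<close> can be added at the cost of finitely many functions, add it. Otherwise every
finite prescription extends, on a set of the filter, to one that forces \<open>N > n\<close>. In that case spend a single
function \<open>f i0\<close> and let \<open>u t\<close> be the set of values listed by \<open>f i0 t\<close> whenever its cardinality is
allowed by \<open>N t\<close>. For finite \<open>L\<close>, the set where \<open>L \<subseteq> u t\<close> contains the points with \<open>u t = L\<close>, that
is, those where \<open>f i0\<close> lists \<open>L\<close> and \<open>N t \<ge> card L\<close>; such points exist under any prescription for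
the other functions, because that prescription extends to one that forces \<open>N > card L\<close>.
\<close>

lemma settle_one_bound:
  fixes f :: "'i \<Rightarrow> 'a \<Rightarrow> 'b list"
  assumes ind: "independent_over f F G" and i0: "i0 \<in> F"
  shows "\<exists>R H. finite R \<and> settles TYPE('b) N H \<and> independent_over f (F - R) (G \<union> H)"
proof (cases "\<exists>n R. finite R \<and> independent_over f (F - R) (G \<union> {{t. N t \<le> enat n}})")
  case True
  then obtain n R where "finite R" "independent_over f (F - R) (G \<union> {{t. N t \<le> enat n}})" by blast
  moreover have "settles TYPE('b) N {{t. N t \<le> enat n}}" unfolding settles_def by blast
  ultimately show ?thesis by blast
next
  case False
  \<comment> \<open>Failure of independence after adding \<open>{t. N t \<le> n}\<close> is witnessed by a prescription \<open>v'\<close> on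
      which \<open>N\<close> must exceed \<open>n\<close>.\<close>
  have dense: "\<exists>\<B> S' v'. \<B> \<subseteq> G \<and> finite \<B> \<and> S' \<subseteq> F - R \<and> finite S' \<and>
      (\<forall>t\<in>\<Inter>\<B>. (\<forall>i\<in>S'. f i t = v' i) \<longrightarrow> enat n < N t)" if R: "finite R" for n R
  proof -
    have "\<not> independent_over f (F - R) (G \<union> {{t. N t \<le> enat n}})" using False R by blast
    then obtain \<A> S' v' where *: "\<A> \<subseteq> G \<union> {{t. N t \<le> enat n}}" "S' \<subseteq> F - R" "finite \<A>" "finite S'"
        "\<not> (\<exists>t\<in>\<Inter>\<A>. \<forall>i\<in>S'. f i t = v' i)"
      unfolding not_independent_over by (elim exE conjE) (rule that; assumption)
    have "enat n < N t" if "t \<in> \<Inter>(\<A> - {{t. N t \<le> enat n}})" "\<forall>i\<in>S'. f i t = v' i" for t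
    proof (rule ccontr)
      assume "\<not> enat n < N t"
      then have "t \<in> \<Inter>\<A>" using that(1) by auto
      then show False using *(5) that(2) by blast
    qed
    then show ?thesis using *(1-4)
      by (intro exI[of _ "\<A> - {{t. N t \<le> enat n}}"] exI[of _ S'] exI[of _ v'] conjI ballI impI) auto
  qed
  define u where "u t = (if enat (card (set (f i0 t))) \<le> N t then set (f i0 t) else {})" for t
  define H where "H = range (\<lambda>a. {t. a \<in> u t})"
  have "settles TYPE('b) N H"
    unfolding settles_def H_def by (intro disjI2 exI[of _ u]) (auto simp: u_def zero_enat_def[symmetric])
  moreover have "independent_over f (F - {i0}) (G \<union> H)"
    unfolding independent_over_def
  proof (intro allI impI)
    fix \<A> S v assume A: "\<A> \<subseteq> G \<union> H" and S: "S \<subseteq> F - {i0}" and fin: "finite \<A>" "finite S"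
    have "\<A> - G \<subseteq> range (\<lambda>a. {t. a \<in> u t})" "finite (\<A> - G)" using A fin unfolding H_def by auto
    then obtain L where L: "finite L" "\<A> - G = (\<lambda>a. {t. a \<in> u t}) ` L"
      by (meson finite_subset_image)
    obtain xs where xs: "set xs = L" using L(1) finite_list by blast
    obtain \<B> S' v' where B: "\<B> \<subseteq> G" "finite \<B>" "S' \<subseteq> F - insert i0 S" "finite S'"
      and big: "\<forall>t\<in>\<Inter>\<B>. (\<forall>i\<in>S'. f i t = v' i) \<longrightarrow> enat (card L) < N t"
      \<comment> \<open>The witness must avoid \<open>i0\<close> and \<open>S\<close>, so that the three prescriptions are compatible.\<close>
      using dense[of "insert i0 S" "card L"] fin by auto
    define w where "w i = (if i = i0 then xs else if i \<in> S then v i else v' i)" for i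
    have "(\<A> \<inter> G) \<union> \<B> \<subseteq> G" "insert i0 (S \<union> S') \<subseteq> F" "finite ((\<A> \<inter> G) \<union> \<B>)"
      "finite (insert i0 (S \<union> S'))"
      using B S fin i0 by auto
    from independent_overD[OF ind this, of w]
    obtain t where t: "t \<in> \<Inter>((\<A> \<inter> G) \<union> \<B>)" "\<forall>i\<in>insert i0 (S \<union> S'). f i t = w i"
      by blast
    have "f i0 t = xs" using t(2) by (simp add: w_def)
    moreover have "\<forall>i\<in>S. f i t = v i" using t(2) S by (auto simp: w_def)
    moreover have "\<forall>i\<in>S'. f i t = v' i" using t(2) B(3) by (auto simp: w_def)
    then have "enat (card L) < N t" using big t(1) by auto
    ultimately have "u t = L" unfolding u_def using xs by auto
    then have "t \<in> X" if "X \<in> \<A> - G" for X using that unfolding L(2) by auto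
    then have "t \<in> \<Inter>\<A>" using t(1) by blast
    then show "\<exists>t\<in>\<Inter>\<A>. \<forall>i\<in>S. f i t = v i" using \<open>\<forall>i\<in>S. f i t = v i\<close> by blast
  qed
  ultimately show ?thesis by blast
qed

lemma card_of_finite_less_infinite:
  assumes "finite A" and "infinite B"
  shows "|A| <o |B|"
  by (rule finite_ordLess_infinite[OF card_of_Well_order card_of_Well_order])
    (simp_all add: Field_card_of assms)

lemma infinite_card_of_Union_finite_sets_less:
  assumes inf: "infinite B" and "|I| <o |B|" and fin: "\<And>i. i \<in> I \<Longrightarrow> finite (R i)"
  shows "|\<Union>i\<in>I. R i| <o |B|"
proof (cases "finite I")
  case True
  then have "finite (\<Union>i\<in>I. R i)" using fin by auto
  then show ?thesis using inf by (simp add: card_of_finite_less_infinite)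
next
  case False
  then have "|\<Union>i\<in>I. R i| \<le>o |I|"
    using fin by (intro card_of_UNION_ordLeq_infinite)
      (auto simp: ordLess_imp_ordLeq card_of_finite_less_infinite intro: card_of_mono1)
  then show ?thesis using assms(2) ordLeq_ordLess_trans by blast
qed

text \<open>
Settle the bounds one after another along a well-order of the index set of least order type. Before
each step fewer than \<open>|UNIV|\<close> bounds have been treated, each at the cost of finitely many functions, so
an unused function remains. The recursion is phrased as an application of Zorn's lemma to partial
histories: sets of triples of a bound's index, the functions spent on it and the sets added for it.
Requiring the treated indices to form an initial segment is what keeps a history that can still be
extended small.
\<close>

lemma settle_all_bounds:
  fixes f :: "'i \<Rightarrow> 'a \<Rightarrow> 'b list" and N :: "'i \<Rightarrow> 'a \<Rightarrow> enat"
  assumes ind: "independent_over f UNIV {}" and inf: "infinite (UNIV :: 'i set)"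
  shows "\<exists>G. finite_intersection_property G \<and> (\<forall>i. settles TYPE('b) (N i) G)"
proof -
  define r where "r = |UNIV :: 'i set|"
  have r: "Card_order r" "Field r = UNIV" "Well_order r"
    using card_of_Card_order[of "UNIV :: 'i set"] card_of_Well_order[of "UNIV :: 'i set"]
    by (simp_all add: r_def Field_card_of)
  interpret r: wo_rel r using r(3) by (simp add: wo_rel_def)
  define used where "used M = (\<Union>(i, R, H)\<in>M. R)" for M :: "('i \<times> 'i set \<times> 'a set set) set"
  define gens where "gens M = (\<Union>(i, R, H)\<in>M. H)" for M :: "('i \<times> 'i set \<times> 'a set set) set"
  define \<S> where "\<S> = {M. inj_on fst M \<and>
      (\<forall>(i, R, H)\<in>M. finite R \<and> settles TYPE('b) (N i) H \<and> under r i \<subseteq> fst ` M) \<and>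
      independent_over f (- used M) (gens M)}"
  have "\<exists>M\<in>\<S>. \<forall>M'\<in>\<S>. M \<subseteq> M' \<longrightarrow> M' = M"
  proof (rule subset_Zorn_nonempty)
    have "{} \<in> \<S>" using ind unfolding \<S>_def used_def gens_def by simp
    then show "\<S> \<noteq> {}" by blast
    fix \<C> assume ne: "\<C> \<noteq> {}" and ch: "subset.chain \<S> \<C>"
    have CS: "\<And>M. M \<in> \<C> \<Longrightarrow> M \<in> \<S>" using ch unfolding subset.chain_def by auto
    have comp: "\<And>M M'. M \<in> \<C> \<Longrightarrow> M' \<in> \<C> \<Longrightarrow> M \<subseteq> M' \<or> M' \<subseteq> M"
      using ch unfolding subset.chain_def by auto
    have "inj_on fst (\<Union>\<C>)"
    proof (rule inj_onI)
      fix x y assume "x \<in> \<Union>\<C>" "y \<in> \<Union>\<C>" and eq: "fst x = fst y"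
      then obtain M where "M \<in> \<C>" "x \<in> M" "y \<in> M" using comp by blast
      then show "x = y" using CS[of M] eq unfolding \<S>_def by (auto dest: inj_onD)
    qed
    moreover have "\<forall>(i, R, H)\<in>\<Union>\<C>. finite R \<and> settles TYPE('b) (N i) H \<and> under r i \<subseteq> fst ` \<Union>\<C>"
    proof (clarify)
      fix i R H M assume "(i, R, H) \<in> M" "M \<in> \<C>"
      then show "finite R \<and> settles TYPE('b) (N i) H \<and> under r i \<subseteq> fst ` \<Union>\<C>"
        using CS[of M] unfolding \<S>_def by fastforce
    qed
    moreover have "independent_over f (- used (\<Union>\<C>)) (gens (\<Union>\<C>))"
      unfolding independent_over_def
    proof (intro allI impI)
      fix \<A> S v assume A: "\<A> \<subseteq> gens (\<Union>\<C>)" and S: "S \<subseteq> - used (\<Union>\<C>)" and fin: "finite \<A>" "finite S"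
      have gens_mono: "gens M \<subseteq> gens M'" if "M \<subseteq> M'" for M M'
        using that unfolding gens_def by blast
      have "\<A> \<subseteq> \<Union>(gens ` \<C>)" using A unfolding gens_def by auto
      moreover have "subset.chain UNIV (gens ` \<C>)"
        unfolding subset_chain_def
      proof (intro conjI ballI)
        fix X Y assume "X \<in> gens ` \<C>" "Y \<in> gens ` \<C>"
        then obtain M M' where "M \<in> \<C>" "M' \<in> \<C>" "X = gens M" "Y = gens M'" by auto
        then show "X \<subseteq> Y \<or> Y \<subseteq> X" using comp[of M M'] gens_mono[of M M'] gens_mono[of M' M] by auto
      qed simp
      moreover have "gens ` \<C> \<noteq> {}" using ne by simp
      ultimately obtain Y where "Y \<in> gens ` \<C>" "\<A> \<subseteq> Y"
        using finite_subset_Union_chain[OF fin(1)] by metis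
      then obtain M where M: "M \<in> \<C>" "\<A> \<subseteq> gens M" by auto
      have "S \<subseteq> - used M" using S M(1) unfolding used_def by blast
      then show "\<exists>t\<in>\<Inter>\<A>. \<forall>i\<in>S. f i t = v i"
        using CS[OF M(1)] M(2) fin unfolding \<S>_def by (auto intro!: independent_overD)
    qed
    ultimately show "\<Union>\<C> \<in> \<S>" unfolding \<S>_def by simp
  qed
  then obtain M where M: "M \<in> \<S>" and max: "\<And>M'. M' \<in> \<S> \<Longrightarrow> M \<subseteq> M' \<Longrightarrow> M' = M" by blast
  have inj: "inj_on fst M" and indM: "independent_over f (- used M) (gens M)"
    and M3: "\<And>i R H. (i, R, H) \<in> M \<Longrightarrow> finite R \<and> settles TYPE('b) (N i) H \<and> under r i \<subseteq> fst ` M"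
    using M unfolding \<S>_def by auto
  have all: "fst ` M = UNIV"
  proof (rule ccontr)
    assume "fst ` M \<noteq> UNIV"
    then have ne: "- fst ` M \<noteq> {}" "- fst ` M \<subseteq> Field r" using r(2) by auto
    \<comment> \<open>The treated indices are then exactly those below the least untreated one, \<open>i\<close>.\<close>
    define i where "i = r.minim (- fst ` M)"
    have i: "i \<notin> fst ` M" using r.minim_in[OF ne(2,1)] unfolding i_def by auto
    have le: "(i, j) \<in> r" if "j \<notin> fst ` M" for j
      using r.minim_least[OF ne(2)] that unfolding i_def by auto
    have below: "underS r i \<subseteq> fst ` M"
    proof
      fix j assume "j \<in> underS r i"
      then have "(j, i) \<in> r" "j \<noteq> i" unfolding underS_def by auto
      then show "j \<in> fst ` M" using le[of j] r.ANTISYM unfolding antisym_def by blast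
    qed
    have "fst ` M \<subseteq> underS r i"
    proof
      fix j assume j: "j \<in> fst ` M"
      then obtain R H where "(j, R, H) \<in> M" by auto
      then have "i \<notin> under r j" using M3 i by blast
      then have "(i, j) \<notin> r" unfolding under_def by simp
      then have "(j, i) \<in> r" using r.TOTALS r(2) by auto
      then show "j \<in> underS r i" using i j unfolding underS_def by auto
    qed
    then have "|fst ` M| \<le>o |underS r i|" by (rule card_of_mono1)
    moreover have "|underS r i| <o r" using card_of_underS[OF r(1)] r(2) by simp
    ultimately have "|fst ` M| <o r" using ordLeq_ordLess_trans by blast
    moreover have "|M| =o |fst ` M|"
      using inj by (meson card_of_ordIso inj_on_imp_bij_betw)
    ultimately have "|M| <o |UNIV :: 'i set|" using ordIso_ordLess_trans unfolding r_def by blast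
    then have "|\<Union>x\<in>M. fst (snd x)| <o |UNIV :: 'i set|"
      using M3 by (intro infinite_card_of_Union_finite_sets_less[OF inf]) auto
    moreover have "(\<Union>x\<in>M. fst (snd x)) = used M" unfolding used_def by force
    ultimately have "used M \<noteq> UNIV" using ordLess_irreflexive by metis
    then obtain i0 where "i0 \<in> - used M" by blast
    from settle_one_bound[OF indM this, of "N i"] obtain R H
      where RH: "finite R" "settles TYPE('b) (N i) H" "independent_over f (- used M - R) (gens M \<union> H)"
      by blast
    let ?M' = "insert (i, R, H) M"
    have "used ?M' = R \<union> used M" "gens ?M' = H \<union> gens M" unfolding used_def gens_def by auto
    then have "independent_over f (- used ?M') (gens ?M')"
      using RH(3) by (simp add: Diff_eq Un_commute Int_commute)
    moreover have "inj_on fst ?M'" using inj i by (auto simp: inj_on_def image_iff)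
    moreover have "under r i \<subseteq> fst ` ?M'" using below unfolding under_def underS_def by auto
    ultimately have "?M' \<in> \<S>" using RH M3 unfolding \<S>_def by fastforce
    then have "(i, R, H) \<in> M" using max[of ?M'] by blast
    then show False using i by force
  qed
  have "finite_intersection_property (gens M)"
    unfolding finite_intersection_property_def
  proof (intro allI impI)
    fix \<A> assume "\<A> \<subseteq> gens M" "finite \<A>"
    then show "\<Inter>\<A> \<noteq> {}" using independent_overD[OF indM, of \<A> "{}"] by auto
  qed
  moreover have "settles TYPE('b) (N i) (gens M)" for i
  proof -
    obtain R H where "(i, R, H) \<in> M" using all by (metis UNIV_I imageE prod.collapse)
    then have "settles TYPE('b) (N i) H" and "H \<subseteq> gens M" using M3 unfolding gens_def by auto
    then show ?thesis unfolding settles_def by (meson subsetD)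
  qed
  ultimately show ?thesis by blast
qed

section \<open>Independent families of maximal size\<close>

lemma card_of_lists_ordLeq_infinite:
  assumes inf: "infinite B" and le: "|A| \<le>o |B|"
  shows "|lists A| \<le>o |B|"
proof -
  have "|{xs \<in> lists A. length xs = n}| \<le>o |B|" for n
  proof (induction n)
    case 0
    have "{xs \<in> lists A. length xs = 0} = {[]}" by auto
    then show ?case using inf by (simp add: card_of_finite_less_infinite ordLess_imp_ordLeq)
  next
    case (Suc n)
    let ?L = "{xs \<in> lists A. length xs = n}"
    have eq: "{xs \<in> lists A. length xs = Suc n} = (\<lambda>(x, xs). x # xs) ` (A \<times> ?L)"
      by (auto simp: length_Suc_conv image_iff)
    have "|(\<lambda>(x, xs). x # xs) ` (A \<times> ?L)| \<le>o |A \<times> ?L|" by (rule card_of_image)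
    moreover have "|A \<times> ?L| \<le>o |B|"
      using Suc.IH by (intro card_of_Sigma_ordLeq_infinite[OF inf le] ballI)
    ultimately show ?case unfolding eq by (rule ordLeq_transitive)
  qed
  then have "|\<Union>n. {xs \<in> lists A. length xs = n}| \<le>o |B|"
    using inf by (intro card_of_UNION_ordLeq_infinite) (auto simp: infinite_iff_card_of_nat)
  moreover have "(\<Union>n. {xs \<in> lists A. length xs = n}) = lists A" by auto
  ultimately show ?thesis by simp
qed

lemma finite_separating_set:
  assumes "finite (S :: ('a \<Rightarrow> 'c) set)"
  shows "\<exists>xs. \<forall>N\<in>S. \<forall>M\<in>S. (\<forall>x\<in>set xs. N x = M x) \<longrightarrow> N = M"
proof -
  define d where "d p = (SOME x. fst p x \<noteq> snd p x)" for p :: "('a \<Rightarrow> 'c) \<times> ('a \<Rightarrow> 'c)"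
  have d: "N (d (N, M)) \<noteq> M (d (N, M))" if "N \<noteq> M" for N M
    using someI_ex[of "\<lambda>x. N x \<noteq> M x"] that unfolding d_def by auto
  obtain xs where xs: "set xs = d ` (S \<times> S)"
    using finite_list[of "d ` (S \<times> S)"] assms by auto
  have "N = M" if "N \<in> S" "M \<in> S" "\<forall>x\<in>set xs. N x = M x" for N M
  proof (rule ccontr)
    assume "N \<noteq> M"
    moreover have "d (N, M) \<in> set xs" using that(1,2) unfolding xs by simp
    ultimately show False using d[of N M] that(3) by blast
  qed
  then show ?thesis by blast
qed

text \<open>
A variant of the Fichtenholz--Kantorovich--Hausdorff construction. A point codes a finite list of
clauses \<open>(c, v)\<close>, where \<open>c\<close> is a finite piece of a graph, and the function with index \<open>N\<close> returns
the value of the clause whose condition \<open>N\<close> satisfies. Finitely many indices can be told apart on a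
finite set, so clauses recording their restrictions to that set realise any prescribed values; and
there are no more such lists than points. The index type is that of all functions into \<open>'c\<close>, so
that the bounds to be settled below can index the family themselves.
\<close>

lemma independent_family_exists:
  assumes inf: "infinite (UNIV :: 'a set)" and le: "|UNIV :: 'c set| \<le>o |UNIV :: 'a set|"
  shows "\<exists>f :: ('a \<Rightarrow> 'c) \<Rightarrow> 'a \<Rightarrow> 'a list. independent_over f UNIV {}"
proof -
  have "|UNIV :: ('a \<times> 'c) set| \<le>o |UNIV :: 'a set|"
    using card_of_Sigma_ordLeq_infinite[OF inf card_of_refl[THEN ordIso_imp_ordLeq], of "\<lambda>_. UNIV :: 'c set"] le
    by simp
  from card_of_lists_ordLeq_infinite[OF inf this] have 1: "|UNIV :: ('a \<times> 'c) list set| \<le>o |UNIV :: 'a set|" by simp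
  have 2: "|UNIV :: 'a list set| \<le>o |UNIV :: 'a set|"
    using card_of_lists_ordLeq_infinite[OF inf ordIso_imp_ordLeq[OF card_of_refl]] by simp
  have "|UNIV :: (('a \<times> 'c) list \<times> 'a list) set| \<le>o |UNIV :: 'a set|"
    using card_of_Sigma_ordLeq_infinite[OF inf 1, of "\<lambda>_. UNIV :: 'a list set"] 2
    by simp
  from card_of_lists_ordLeq_infinite[OF inf this]
  have "|UNIV :: (('a \<times> 'c) list \<times> 'a list) list set| \<le>o |UNIV :: 'a set|" by simp
  then obtain \<phi> :: "'a \<Rightarrow> (('a \<times> 'c) list \<times> 'a list) list" where \<phi>: "surj \<phi>"
    by (metis card_of_ordLeq2 UNIV_not_empty)
  \<comment> \<open>The value is unspecified where no clause, or more than one value, matches.\<close>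
  define f :: "('a \<Rightarrow> 'c) \<Rightarrow> 'a \<Rightarrow> 'a list" where
    "f N t = (THE v. \<exists>c. (c, v) \<in> set (\<phi> t) \<and> (\<forall>(x, y)\<in>set c. N x = y))" for N t
  have "independent_over f UNIV {}"
    unfolding independent_over_def
  proof (intro allI impI)
    fix \<A> :: "'a set set" and S :: "('a \<Rightarrow> 'c) set" and v assume A: "\<A> \<subseteq> {}" and S: "finite S"
    obtain xs where xs: "\<forall>N\<in>S. \<forall>M\<in>S. (\<forall>x\<in>set xs. N x = M x) \<longrightarrow> N = M"
      using finite_separating_set[OF S] by blast
    obtain Ns where Ns: "set Ns = S" using finite_list[OF S] by blast
    define t where "t = inv \<phi> (map (\<lambda>N. (map (\<lambda>x. (x, N x)) xs, v N)) Ns)"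
    have t: "\<phi> t = map (\<lambda>N. (map (\<lambda>x. (x, N x)) xs, v N)) Ns"
      unfolding t_def by (rule surj_f_inv_f[OF \<phi>])
    have "f N t = v N" if "N \<in> S" for N
      unfolding f_def
    proof (rule the_equality)
      show "\<exists>c. (c, v N) \<in> set (\<phi> t) \<and> (\<forall>(x, y)\<in>set c. N x = y)"
        using that unfolding t by (auto simp: Ns image_iff)
      fix w assume "\<exists>c. (c, w) \<in> set (\<phi> t) \<and> (\<forall>(x, y)\<in>set c. N x = y)"
      then obtain M where "M \<in> S" "w = v M" "\<forall>x\<in>set xs. N x = M x"
        unfolding t by (auto simp: Ns)
      then show "w = v N" using xs that by metis
    qed
    then show "\<exists>t\<in>\<Inter>\<A>. \<forall>i\<in>S. f i t = v i" using A by auto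
  qed
  then show ?thesis by blast
qed

section \<open>Regular flexible ultrafilters\<close>

text \<open>
Once every bound is settled by a family with the finite intersection property, any ultrafilter
containing the family is flexible: if all \<open>{t. h t > n}\<close> are large, no \<open>{t. h t \<le> n}\<close> can belong to the
family, which leaves the other alternative. The constant bound \<open>\<infinity>\<close> makes it regular.
\<close>

theorem regular_flexible_ultrafilter_exists:
  assumes inf: "infinite (UNIV :: 'a set)"
  shows "\<exists>D :: 'a filter. ultrafilter D \<and> regular_filter D \<and> flexible |UNIV :: 'a set| D"
proof -
  have "|UNIV :: enat set| \<le>o |UNIV :: nat set|"
  proof -
    have "range (case_option \<infinity> enat) = (UNIV :: enat set)"
      by (auto simp: image_iff split: option.splits) (metis enat.exhaust option.simps(4,5))
    then have "|UNIV :: enat set| \<le>o |UNIV :: nat option set|"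
      using card_of_image[of "case_option \<infinity> enat" UNIV] by simp
    also have "|UNIV :: nat option set| \<le>o |UNIV :: nat set|"
      using card_of_ordLeqI[of "to_nat :: nat option \<Rightarrow> nat" UNIV UNIV] by simp
    finally show ?thesis .
  qed
  then have "|UNIV :: enat set| \<le>o |UNIV :: 'a set|"
    using inf infinite_iff_card_of_nat ordLeq_transitive by blast
  from independent_family_exists[OF inf this]
  obtain f :: "('a \<Rightarrow> enat) \<Rightarrow> 'a \<Rightarrow> 'a list" where f: "independent_over f UNIV {}" by blast
  have "infinite (UNIV :: ('a \<Rightarrow> enat) set)"
  proof
    assume "finite (UNIV :: ('a \<Rightarrow> enat) set)"
    then have "finite (range (\<lambda>a::'a. (\<lambda>x. if x = a then 0 else \<infinity> :: enat)))"
      by (rule finite_subset[OF subset_UNIV])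
    moreover have "inj (\<lambda>a::'a. (\<lambda>x. if x = a then 0 else \<infinity> :: enat))"
      by (rule injI, drule_tac x=x in fun_cong) (auto split: if_splits)
    ultimately show False using inf finite_imageD by blast
  qed
  from settle_all_bounds[OF f this, of "\<lambda>N. N"] obtain G :: "'a set set"
    where G: "finite_intersection_property G" and "\<forall>N. settles TYPE('a) N G" by blast
  then have settled: "settles TYPE('a) N G" for N by blast
  obtain D where D: "ultrafilter D" "G \<subseteq> filter_sets D"
    using ultrafilter_extending_fip[OF G] by blast
  have proper: "{} \<notin> filter_sets D"
    using D(1) unfolding ultrafilter_def filter_sets_def by (simp add: trivial_limit_def)
  have "regular_filter D"
  proof -
    have "{} \<notin> G" using D(2) proper by blast
    then obtain u :: "'a \<Rightarrow> 'a set" where u: "\<forall>t. finite (u t)" "\<forall>a. {t. a \<in> u t} \<in> G"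
      using settled[of "\<lambda>_. \<infinity>"] unfolding settles_def by auto
    then show ?thesis
      unfolding regular_filter_def using D(2) by (intro exI[of _ "\<lambda>a. {t. a \<in> u t}"]) auto
  qed
  moreover have "flexible |UNIV :: 'a set| D"
    unfolding flexible_def
  proof (intro allI impI)
    fix h :: "'a \<Rightarrow> nat" assume h: "\<forall>n. {t. n < h t} \<in> filter_sets D"
    have "{t. enat (h t) \<le> enat n} \<notin> G" for n
    proof
      assume "{t. enat (h t) \<le> enat n} \<in> G"
      then have "eventually (\<lambda>t. h t \<le> n) D" using D(2) unfolding filter_sets_def by auto
      moreover have "eventually (\<lambda>t. n < h t) D" using h unfolding filter_sets_def by auto
      ultimately have "eventually (\<lambda>t. False) D" by eventually_elim auto
      then show False using proper unfolding filter_sets_def by simp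
    qed
    then obtain u :: "'a \<Rightarrow> 'a set" where u: "\<forall>t. finite (u t) \<and> card (u t) \<le> h t" "\<forall>a. {t. a \<in> u t} \<in> G"
      using settled[of "\<lambda>t. enat (h t)"] unfolding settles_def by auto
    then show "\<exists>X :: 'a \<Rightarrow> 'a set. (\<forall>\<alpha>\<in>Field |UNIV :: 'a set|. X \<alpha> \<in> filter_sets D) \<and>
        (\<forall>t. finite {\<alpha> \<in> Field |UNIV :: 'a set|. t \<in> X \<alpha>} \<and> card {\<alpha> \<in> Field |UNIV :: 'a set|. t \<in> X \<alpha>} \<le> h t)"
      using D(2) by (intro exI[of _ "\<lambda>a. {t. a \<in> u t}"]) (auto simp: Field_card_of)
  qed
  ultimately show ?thesis using D(1) by blast
qed

section \<open>Regular, flexible and OK filters\<close>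

text \<open>
A large set \<open>Y\<close> meets all sets of the regularizing family, and each of its points lies in only
finitely many of them; so a \<open>Y\<close> of smaller cardinality could not exhaust the index set.
\<close>

lemma regular_imp_uniform:
  fixes D :: "'a filter"
  assumes reg: "regular_filter D" and "D \<noteq> bot" and inf: "infinite (UNIV :: 'a set)"
  shows "uniform_filter D"
  unfolding uniform_filter_def
proof
  fix Y assume Y: "Y \<in> filter_sets D"
  obtain X :: "'a \<Rightarrow> 'a set" where X: "\<And>i. X i \<in> filter_sets D" and fin: "\<And>t. finite {i. t \<in> X i}"
    using reg unfolding regular_filter_def by blast
  have "\<exists>t\<in>Y. t \<in> X i" for i
  proof -
    have "eventually (\<lambda>t. t \<in> Y \<and> t \<in> X i) D"
      using Y X[of i] unfolding filter_sets_def by (auto intro: eventually_conj)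
    then show ?thesis using eventually_happens' \<open>D \<noteq> bot\<close> by blast
  qed
  then have cover: "(\<Union>t\<in>Y. {i. t \<in> X i}) = UNIV" by auto
  have "\<not> |Y| <o |UNIV :: 'a set|"
  proof
    assume "|Y| <o |UNIV :: 'a set|"
    then have "|\<Union>t\<in>Y. {i. t \<in> X i}| <o |UNIV :: 'a set|"
      by (rule infinite_card_of_Union_finite_sets_less[OF inf _ fin])
    then show False unfolding cover using ordLess_irreflexive by blast
  qed
  then have "|UNIV :: 'a set| \<le>o |Y|" using ordLess_or_ordLeq[OF card_of_Well_order card_of_Well_order] by blast
  moreover have "|Y| \<le>o |UNIV :: 'a set|" by (rule card_of_mono1) simp
  ultimately show "|Y| =o |UNIV :: 'a set|" by (simp add: ordIso_iff_ordLeq)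
qed

lemma flexible_mono:
  fixes D :: "'a filter"
  assumes flex: "flexible \<nu> D" and le: "|Field \<mu>| \<le>o |Field \<nu>|"
  shows "flexible \<mu> D"
  unfolding flexible_def
proof (intro allI impI)
  fix h :: "'a \<Rightarrow> nat" assume "\<forall>n. {t. n < h t} \<in> filter_sets D"
  then obtain X where X: "\<forall>\<alpha>\<in>Field \<nu>. X \<alpha> \<in> filter_sets D"
    and small: "\<And>t. finite {\<alpha> \<in> Field \<nu>. t \<in> X \<alpha>} \<and> card {\<alpha> \<in> Field \<nu>. t \<in> X \<alpha>} \<le> h t"
    using flex unfolding flexible_def by blast
  obtain e where e: "inj_on e (Field \<mu>)" "e ` Field \<mu> \<subseteq> Field \<nu>"
    using iffD2[OF card_of_ordLeq le] by blast
  have "finite {\<alpha> \<in> Field \<mu>. t \<in> X (e \<alpha>)} \<and> card {\<alpha> \<in> Field \<mu>. t \<in> X (e \<alpha>)} \<le> h t" for t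
  proof -
    have "inj_on e {\<alpha> \<in> Field \<mu>. t \<in> X (e \<alpha>)}" using e(1) by (rule inj_on_subset) auto
    moreover have "e ` {\<alpha> \<in> Field \<mu>. t \<in> X (e \<alpha>)} \<subseteq> {\<alpha> \<in> Field \<nu>. t \<in> X \<alpha>}" using e(2) by auto
    ultimately show ?thesis using small[of t]
      by (meson inj_on_finite card_inj_on_le order_trans)
  qed
  then show "\<exists>X. (\<forall>\<alpha>\<in>Field \<mu>. X \<alpha> \<in> filter_sets D) \<and>
      (\<forall>t. finite {\<alpha> \<in> Field \<mu>. t \<in> X \<alpha>} \<and> card {\<alpha> \<in> Field \<mu>. t \<in> X \<alpha>} \<le> h t)"
    using X e(2) by (intro exI[of _ "\<lambda>\<alpha>. X (e \<alpha>)"]) auto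
qed

lemma regular_unbounded_function:
  fixes D :: "'a filter"
  assumes reg: "regular_filter D" and inf: "infinite (UNIV :: 'a set)"
  shows "\<exists>h :: 'a \<Rightarrow> nat. \<forall>n. eventually (\<lambda>t. n < h t) D"
proof -
  obtain X :: "'a \<Rightarrow> 'a set" where X: "\<And>i. X i \<in> filter_sets D" and fin: "\<And>t. finite {i. t \<in> X i}"
    using reg unfolding regular_filter_def by blast
  have "eventually (\<lambda>t. n < card {i. t \<in> X i}) D" for n
  proof -
    obtain B :: "'a set" where B: "finite B" "card B = Suc n"
      using infinite_arbitrarily_large[OF inf] by blast
    have "eventually (\<lambda>t. \<forall>i\<in>B. t \<in> X i) D"
      using B(1) X unfolding filter_sets_def by (intro eventually_ball_finite) auto
    then show ?thesis
    proof eventually_elim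
      case (elim t)
      then have "card B \<le> card {i. t \<in> X i}" by (intro card_mono fin) auto
      then show ?case using B(2) by simp
    qed
  qed
  then show ?thesis by (intro exI[of _ "\<lambda>t. card {i. t \<in> X i}"] allI)
qed

text \<open>
A symmetric monotone \<open>f\<close> amounts to a decreasing sequence of large sets, the values of \<open>f\<close> at sets
\<open>c n\<close> of size \<open>n\<close>. Let \<open>h t\<close> be how far \<open>t\<close> survives in that sequence, cut off by an unbounded function
coming from regularity so as to be finite. Flexibility gives sets \<open>X \<alpha>\<close>
such that \<open>t\<close> lies in at most \<open>h t\<close> of them; if \<open>t\<close> lies in \<open>X \<alpha>\<close> for all \<open>\<alpha> \<in> u\<close>, then \<open>card u \<le> h t\<close>,
hence \<open>t \<in> f u\<close>, provided that \<open>t \<in> f {}\<close>.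
\<close>

lemma flexible_imp_OK:
  fixes D :: "'a filter" and \<mu> :: "'b rel"
  assumes flex: "flexible \<mu> D" and reg: "regular_filter D"
    and inf: "infinite (UNIV :: 'a set)" and inf\<mu>: "infinite (Field \<mu>)"
  shows "OK \<mu> D"
  unfolding OK_def
proof (intro allI impI)
  fix f :: "'b set \<Rightarrow> 'a set"
  assume fD: "\<forall>u\<in>Fpow (Field \<mu>). f u \<in> filter_sets D"
    and anti: "antimono_on (Fpow (Field \<mu>)) f"
    and sym: "\<forall>u\<in>Fpow (Field \<mu>). \<forall>v\<in>Fpow (Field \<mu>). card u = card v \<longrightarrow> f u = f v"
  obtain c where c: "\<And>n. c n \<subseteq> Field \<mu> \<and> finite (c n) \<and> card (c n) = n"
    using infinite_arbitrarily_large[OF inf\<mu>] by metis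
  have cF: "c n \<in> Fpow (Field \<mu>)" for n using c by (simp add: Fpow_def)
  have f_c: "f u = f (c (card u))" if "u \<in> Fpow (Field \<mu>)" for u
    using bspec[OF bspec[OF sym that] cF[of "card u"]] c[of "card u"] by simp
  have dec: "f (c n) \<subseteq> f (c m)" if le: "m \<le> n" for m n
  proof -
    obtain v where v: "v \<subseteq> c n" "card v = m" using le c[of n] by (metis obtain_subset_with_card_n)
    then have vF: "v \<in> Fpow (Field \<mu>)" using c[of n] by (auto simp: Fpow_def intro: finite_subset)
    then have "f (c n) \<subseteq> f v" using monotone_onD[OF anti vF cF v(1)] by simp
    then show ?thesis using f_c[OF vF] v(2) by simp
  qed
  obtain h0 :: "'a \<Rightarrow> nat" where h0: "\<And>n. eventually (\<lambda>t. n < h0 t) D"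
    using regular_unbounded_function[OF reg inf] by blast
  define h where "h t = Max (insert 0 {n. n \<le> h0 t \<and> t \<in> f (c n)})" for t
  have h_mem: "t \<in> f (c n)" if "n \<le> h t" "t \<in> f (c 0)" for n t
  proof -
    have "h t \<in> insert 0 {n. n \<le> h0 t \<and> t \<in> f (c n)}"
      unfolding h_def by (rule Max_in) auto
    then have "t \<in> f (c (h t))" using that(2) by auto
    then show ?thesis using dec[OF that(1)] by blast
  qed
  have "{t. n < h t} \<in> filter_sets D" for n
  proof -
    have "eventually (\<lambda>t. t \<in> f (c (Suc n))) D" using fD cF unfolding filter_sets_def by simp
    with h0[of n] have "eventually (\<lambda>t. n < h t) D"
    proof eventually_elim
      case (elim t)
      then have "Suc n \<le> h t" unfolding h_def by (intro Max_ge) auto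
      then show ?case by simp
    qed
    then show ?thesis unfolding filter_sets_def by simp
  qed
  then obtain X where X: "\<forall>\<alpha>\<in>Field \<mu>. X \<alpha> \<in> filter_sets D"
    and small: "\<And>t. finite {\<alpha> \<in> Field \<mu>. t \<in> X \<alpha>} \<and> card {\<alpha> \<in> Field \<mu>. t \<in> X \<alpha>} \<le> h t"
    using flex unfolding flexible_def by blast
  \<comment> \<open>The factor \<open>f (c 0) = f {}\<close> serves the points with \<open>h t = 0\<close>, which may lie outside every \<open>f u\<close>.\<close>
  define g where "g u = {t \<in> f (c 0). \<forall>\<alpha>\<in>u. t \<in> X \<alpha>}" for u
  have "g u \<in> filter_sets D \<and> g u \<subseteq> f u" if u: "u \<in> Fpow (Field \<mu>)" for u
  proof
    have "finite u" "u \<subseteq> Field \<mu>" using u by (auto simp: Fpow_def)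
    then have "eventually (\<lambda>t. \<forall>\<alpha>\<in>u. t \<in> X \<alpha>) D"
      using X unfolding filter_sets_def by (intro eventually_ball_finite) auto
    moreover have "eventually (\<lambda>t. t \<in> f (c 0)) D" using fD cF unfolding filter_sets_def by simp
    ultimately show "g u \<in> filter_sets D"
      unfolding g_def filter_sets_def by (simp add: eventually_conj)
    show "g u \<subseteq> f u"
    proof
      fix t assume t: "t \<in> g u"
      then have "card u \<le> card {\<alpha> \<in> Field \<mu>. t \<in> X \<alpha>}"
        using small \<open>u \<subseteq> Field \<mu>\<close> unfolding g_def by (intro card_mono) auto
      then have "card u \<le> h t" using small[of t] by linarith
      then show "t \<in> f u" using h_mem t f_c[OF u] unfolding g_def by simp
    qed
  qed
  moreover have "g u \<inter> g v = g (u \<union> v)" for u v unfolding g_def by auto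
  ultimately show "\<exists>g. multiplicative_refinement D \<mu> f g"
    unfolding multiplicative_refinement_def by blast
qed

section \<open>Ultrafilters witnessing measurability\<close>

lemma ultrafilter_iff:
  "ultrafilter D \<longleftrightarrow> D \<noteq> bot \<and> (\<forall>P. eventually P D \<or> eventually (\<lambda>t. \<not> P t) D)"
proof -
  have "(\<forall>X. X \<in> filter_sets D \<or> - X \<in> filter_sets D) \<longleftrightarrow>
      (\<forall>P. eventually P D \<or> eventually (\<lambda>t. \<not> P t) D)"
  proof (intro iffI allI)
    fix P assume "\<forall>X. X \<in> filter_sets D \<or> - X \<in> filter_sets D"
    from spec[OF this, of "{t. P t}"] show "eventually P D \<or> eventually (\<lambda>t. \<not> P t) D"
      by (simp add: filter_sets_def)
  next
    fix X assume "\<forall>P. eventually P D \<or> eventually (\<lambda>t. \<not> P t) D"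
    from spec[OF this, of "\<lambda>t. t \<in> X"] show "X \<in> filter_sets D \<or> - X \<in> filter_sets D"
      by (simp add: filter_sets_def)
  qed
  then show ?thesis unfolding ultrafilter_def by simp
qed

lemma complete_filter_ball:
  assumes comp: "complete_filter \<kappa> E" and small: "|I| <o \<kappa>"
    and ev: "\<And>i. i \<in> I \<Longrightarrow> eventually (P i) E"
  shows "eventually (\<lambda>k. \<forall>i\<in>I. P i k) E"
proof -
  define \<A> where "\<A> = (\<lambda>i. {k. P i k}) ` I"
  have "|\<A>| <o \<kappa>" unfolding \<A>_def using ordLeq_ordLess_trans[OF card_of_image small] .
  moreover have "\<A> \<subseteq> filter_sets E" unfolding \<A>_def filter_sets_def using ev by auto
  ultimately have "\<Inter>\<A> \<in> filter_sets E" using comp unfolding complete_filter_def by blast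
  then show ?thesis unfolding filter_sets_def \<A>_def by simp
qed

lemma complete_filter_all_nat:
  assumes "complete_filter \<kappa> E" and "natLeq <o \<kappa>" and "\<And>n::nat. eventually (P n) E"
  shows "eventually (\<lambda>k. \<forall>n. P n k) E"
  using complete_filter_ball[OF assms(1), of UNIV P] ordIso_ordLess_trans[OF card_of_nat assms(2)] assms(3)
  by simp

lemma nonprincipal_ultrafilter_avoids_point:
  assumes U: "ultrafilter U" and nonprincipal: "\<nexists>A. U = principal A"
  shows "eventually (\<lambda>k. k \<noteq> x) U"
proof (rule ccontr)
  assume "\<not> eventually (\<lambda>k. k \<noteq> x) U"
  then have x: "eventually (\<lambda>k. k = x) U" using U unfolding ultrafilter_iff by fastforce
  have "U = principal {x}"
    unfolding filter_eq_iff
  proof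
    fix P
    show "eventually P U \<longleftrightarrow> eventually P (principal {x})"
    proof (cases "P x")
      case True
      then show ?thesis using x by (auto simp: eventually_principal elim: eventually_mono)
    next
      case False
      have "\<not> eventually P U"
      proof
        assume "eventually P U"
        with x have "eventually (\<lambda>k. False) U" by eventually_elim (use False in auto)
        then show False using U unfolding ultrafilter_iff by (simp add: trivial_limit_def)
      qed
      then show ?thesis using False by (simp add: eventually_principal)
    qed
  qed
  then show False using nonprincipal by blast
qed

text \<open>
Otherwise the points of \<open>'k\<close> would be coded by distinct subsets of \<open>A\<close>. By completeness the
ultrafilter decides all members of the code at once, so it concentrates on a single point.
\<close>

lemma measurable_strong_limit:
  fixes U :: "'k filter"
  assumes U: "ultrafilter U" and nonprincipal: "\<nexists>A. U = principal A"
    and comp: "complete_filter \<kappa> U" and small: "|A| <o \<kappa>"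
  shows "|Pow A| \<le>o |UNIV :: 'k set|"
proof -
  have "\<not> |UNIV :: 'k set| \<le>o |Pow A|"
  proof
    assume "|UNIV :: 'k set| \<le>o |Pow A|"
    then obtain e :: "'k \<Rightarrow> 'b set" where e: "inj e" "range e \<subseteq> Pow A"
      by (auto simp: card_of_ordLeq[symmetric])
    define s where "s a \<longleftrightarrow> eventually (\<lambda>k. a \<in> e k) U" for a
    have "eventually (\<lambda>k. a \<in> e k \<longleftrightarrow> s a) U" for a
    proof (cases "s a")
      case True
      then show ?thesis unfolding s_def by simp
    next
      case False
      then have "eventually (\<lambda>k. a \<notin> e k) U" using U unfolding ultrafilter_iff s_def by blast
      then show ?thesis using False by simp
    qed
    then have "eventually (\<lambda>k. \<forall>a\<in>A. a \<in> e k \<longleftrightarrow> s a) U" by (rule complete_filter_ball[OF comp small])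
    then have ev: "eventually (\<lambda>k. e k = {a\<in>A. s a}) U"
      by (rule eventually_mono) (use e(2) in auto)
    then obtain x where x: "e x = {a\<in>A. s a}"
      using U eventually_happens' unfolding ultrafilter_iff by blast
    have "eventually (\<lambda>k. k \<noteq> x) U" by (rule nonprincipal_ultrafilter_avoids_point[OF U nonprincipal])
    with ev have "eventually (\<lambda>k. False) U"
      by eventually_elim (metis x e(1) injD)
    then show False using U unfolding ultrafilter_iff by (simp add: trivial_limit_def)
  qed
  then show ?thesis
    using ordLeq_total[OF card_of_Well_order[of "Pow A"] card_of_Well_order[of "UNIV :: 'k set"]] by blast
qed

lemma measurable_final_segment:
  fixes \<kappa> :: "'k rel"
  assumes \<kappa>: "card_order \<kappa>" and U: "ultrafilter U" and nonprincipal: "\<nexists>A. U = principal A"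
    and comp: "complete_filter \<kappa> U"
  shows "eventually (\<lambda>k. x \<in> underS \<kappa> k) U"
proof -
  have \<kappa>': "Card_order \<kappa>" "Field \<kappa> = UNIV" using \<kappa> card_order_on_Card_order by auto
  interpret wo_rel \<kappa> using \<kappa>'(1) unfolding wo_rel_def card_order_on_def by simp
  note avoid = nonprincipal_ultrafilter_avoids_point[OF U nonprincipal]
  have "eventually (\<lambda>k. \<forall>y\<in>underS x. k \<noteq> y) U"
    using avoid card_of_underS[OF \<kappa>'(1)] \<kappa>'(2) by (intro complete_filter_ball[OF comp]) auto
  with avoid[of x] show ?thesis
  proof eventually_elim
    case (elim k)
    then have "(k, x) \<notin> \<kappa>" unfolding underS_def by auto
    then have "(x, k) \<in> \<kappa>" using TOTALS \<kappa>'(2) by auto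
    then show ?case using elim(1) unfolding underS_def by auto
  qed
qed

section \<open>The Fubini product\<close>

definition fubini_product :: "'k filter \<Rightarrow> 'a filter \<Rightarrow> ('k \<times> 'a) filter" where
  "fubini_product E D = Abs_filter (\<lambda>P. eventually (\<lambda>k. eventually (\<lambda>i. P (k, i)) D) E)"

lemma eventually_fubini_product:
  "eventually P (fubini_product E D) \<longleftrightarrow> eventually (\<lambda>k. eventually (\<lambda>i. P (k, i)) D) E"
proof -
  have "is_filter (\<lambda>P. eventually (\<lambda>k. eventually (\<lambda>i. P (k, i)) D) E)"
  proof
    show "eventually (\<lambda>k. eventually (\<lambda>i. P (k, i) \<and> Q (k, i)) D) E"
      if "eventually (\<lambda>k. eventually (\<lambda>i. P (k, i)) D) E" "eventually (\<lambda>k. eventually (\<lambda>i. Q (k, i)) D) E"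
      for P Q using that by eventually_elim (rule eventually_conj)
    show "eventually (\<lambda>k. eventually (\<lambda>i. Q (k, i)) D) E"
      if "\<forall>x. P x \<longrightarrow> Q x" "eventually (\<lambda>k. eventually (\<lambda>i. P (k, i)) D) E" for P Q
      using that(2) by eventually_elim (erule eventually_mono, use that(1) in blast)
  qed simp
  then show ?thesis unfolding fubini_product_def by (rule eventually_Abs_filter)
qed

lemma ultrafilter_filtermap_fubini_product:
  assumes E: "ultrafilter E" and D: "ultrafilter D"
  shows "ultrafilter (filtermap b (fubini_product E D))"
  unfolding ultrafilter_iff trivial_limit_def eventually_filtermap eventually_fubini_product
proof (intro conjI allI)
  have "\<not> eventually (\<lambda>i. False) D" "\<not> eventually (\<lambda>k. False) E"
    using E D unfolding ultrafilter_iff by (simp_all add: trivial_limit_def)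
  then show "\<not> eventually (\<lambda>k. eventually (\<lambda>i. False) D) E" by simp
  fix P
  show "eventually (\<lambda>k. eventually (\<lambda>i. P (b (k, i))) D) E \<or>
      eventually (\<lambda>k. eventually (\<lambda>i. \<not> P (b (k, i))) D) E"
  proof (rule disjCI)
    assume "\<not> eventually (\<lambda>k. eventually (\<lambda>i. \<not> P (b (k, i))) D) E"
    then have "eventually (\<lambda>k. \<not> eventually (\<lambda>i. \<not> P (b (k, i))) D) E"
      using E unfolding ultrafilter_iff by blast
    then show "eventually (\<lambda>k. eventually (\<lambda>i. P (b (k, i))) D) E"
      by eventually_elim (use D in \<open>auto simp: ultrafilter_iff\<close>)
  qed
qed

lemma regular_filtermap_fubini_product:
  fixes b :: "'k \<times> 'a \<Rightarrow> 'a"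
  assumes b: "inj b" and reg: "regular_filter D"
  shows "regular_filter (filtermap b (fubini_product E D))"
proof -
  obtain X :: "'a \<Rightarrow> 'a set" where X: "\<And>i. X i \<in> filter_sets D" and fin: "\<And>t. finite {i. t \<in> X i}"
    using reg unfolding regular_filter_def by blast
  have "{t. snd (inv b t) \<in> X i} \<in> filter_sets (filtermap b (fubini_product E D))" for i
    using X[of i] unfolding filter_sets_def by (simp add: eventually_filtermap eventually_fubini_product b)
  then show ?thesis
    unfolding regular_filter_def using fin by (intro exI[of _ "\<lambda>i. {t. snd (inv b t) \<in> X i}"]) simp
qed

text \<open>
By countable completeness, almost every section of an unbounded \<open>h\<close> is unbounded in the sense of
\<open>D\<close>. Flexibility of \<open>D\<close> applies to each of these sections separately, and the remaining sections
contribute nothing.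
\<close>

lemma flexible_filtermap_fubini_product:
  fixes b :: "'k \<times> 'a \<Rightarrow> 'c"
  assumes b: "inj b" and flex: "flexible \<mu> D"
    and comp: "complete_filter \<kappa> E" and unc: "natLeq <o \<kappa>"
  shows "flexible \<mu> (filtermap b (fubini_product E D))"
  unfolding flexible_def
proof (intro allI impI)
  fix h :: "'c \<Rightarrow> nat"
  assume h: "\<forall>n. {t. n < h t} \<in> filter_sets (filtermap b (fubini_product E D))"
  define K where "K = {k. \<forall>n. {i. n < h (b (k, i))} \<in> filter_sets D}"
  have "eventually (\<lambda>k. {i. n < h (b (k, i))} \<in> filter_sets D) E" for n
    using h unfolding filter_sets_def by (simp add: eventually_filtermap eventually_fubini_product)
  from complete_filter_all_nat[OF comp unc this] have K: "eventually (\<lambda>k. k \<in> K) E" unfolding K_def by simp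
  have "\<exists>X. (\<forall>\<alpha>\<in>Field \<mu>. X \<alpha> \<in> filter_sets D) \<and>
      (\<forall>i. finite {\<alpha> \<in> Field \<mu>. i \<in> X \<alpha>} \<and> card {\<alpha> \<in> Field \<mu>. i \<in> X \<alpha>} \<le> h (b (k, i)))"
    if "k \<in> K" for k
    using flex[unfolded flexible_def, rule_format, of "\<lambda>i. h (b (k, i))"] that unfolding K_def by simp
  then have "\<forall>k\<in>K. \<exists>X. (\<forall>\<alpha>\<in>Field \<mu>. X \<alpha> \<in> filter_sets D) \<and>
      (\<forall>i. finite {\<alpha> \<in> Field \<mu>. i \<in> X \<alpha>} \<and> card {\<alpha> \<in> Field \<mu>. i \<in> X \<alpha>} \<le> h (b (k, i)))"
    by (rule ballI)
  from bchoice[OF this] obtain X where "\<forall>k\<in>K. (\<forall>\<alpha>\<in>Field \<mu>. X k \<alpha> \<in> filter_sets D) \<and>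
      (\<forall>i. finite {\<alpha> \<in> Field \<mu>. i \<in> X k \<alpha>} \<and> card {\<alpha> \<in> Field \<mu>. i \<in> X k \<alpha>} \<le> h (b (k, i)))"
    by (elim exE) (rule that)
  then have X: "\<And>k \<alpha>. k \<in> K \<Longrightarrow> \<alpha> \<in> Field \<mu> \<Longrightarrow> X k \<alpha> \<in> filter_sets D"
    and small: "\<And>k i. k \<in> K \<Longrightarrow> finite {\<alpha> \<in> Field \<mu>. i \<in> X k \<alpha>} \<and>
      card {\<alpha> \<in> Field \<mu>. i \<in> X k \<alpha>} \<le> h (b (k, i))"
    by simp_all
  define Y where "Y \<alpha> = b ` {(k, i). k \<in> K \<and> i \<in> X k \<alpha>}" for \<alpha>
  have mem: "b (k, i) \<in> Y \<alpha> \<longleftrightarrow> k \<in> K \<and> i \<in> X k \<alpha>" for k i \<alpha>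
    unfolding Y_def using b by (auto dest: injD)
  have "Y \<alpha> \<in> filter_sets (filtermap b (fubini_product E D))" if "\<alpha> \<in> Field \<mu>" for \<alpha>
    unfolding filter_sets_def mem_Collect_eq eventually_filtermap eventually_fubini_product mem
    using K by eventually_elim (use X that in \<open>simp add: filter_sets_def\<close>)
  moreover have "finite {\<alpha> \<in> Field \<mu>. t \<in> Y \<alpha>} \<and> card {\<alpha> \<in> Field \<mu>. t \<in> Y \<alpha>} \<le> h t" for t
  proof (cases "\<exists>k i. k \<in> K \<and> t = b (k, i)")
    case True
    then obtain k i where k: "k \<in> K" and t: "t = b (k, i)" by blast
    show ?thesis using small[OF k, of i] k unfolding t mem by simp
  next
    case False
    then have "t \<notin> Y \<alpha>" for \<alpha> unfolding Y_def by auto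
    then show ?thesis by simp
  qed
  ultimately show "\<exists>X. (\<forall>\<alpha>\<in>Field \<mu>. X \<alpha> \<in> filter_sets (filtermap b (fubini_product E D))) \<and>
      (\<forall>t. finite {\<alpha> \<in> Field \<mu>. t \<in> X \<alpha>} \<and> card {\<alpha> \<in> Field \<mu>. t \<in> X \<alpha>} \<le> h t)"
    by blast
qed

text \<open>
For \<open>A \<noteq> B\<close> the traces \<open>A \<inter> underS \<kappa> k\<close> and \<open>B \<inter> underS \<kappa> k\<close> differ for almost all \<open>k\<close>. Let \<open>f u\<close>
say that the sets \<open>A\<close> indexed by \<open>u\<close> have distinct traces at the first coordinate. A multiplicative
refinement \<open>g\<close> yields for each \<open>A\<close> some \<open>\<tau> A\<close> at which the section of \<open>g {j A}\<close> is in \<open>D\<close>. If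
\<open>\<tau> A = \<tau> B\<close>, two such sections intersect, so the traces of \<open>A\<close> and \<open>B\<close> at that point are distinct.
Thus \<open>A\<close> is determined by \<open>\<tau> A\<close> and its trace there; but, \<open>\<kappa>\<close> being a strong limit, there are only
\<open>\<kappa>\<close> such pairs.
\<close>

lemma not_succ_good_filtermap_fubini_product:
  fixes \<kappa> :: "'k rel" and \<mu> :: "'b rel" and b :: "'k \<times> 'a \<Rightarrow> 'c"
  assumes \<kappa>: "card_order \<kappa>" and unc: "natLeq <o \<kappa>"
    and E: "ultrafilter E" "\<nexists>A. E = principal A" "complete_filter \<kappa> E"
    and D: "D \<noteq> bot" and b: "inj b"
    and large: "|UNIV :: 'k set set| \<le>o |Field \<mu>|"
  shows "\<not> succ_good \<mu> (filtermap b (fubini_product E D))"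
proof
  let ?F = "filtermap b (fubini_product E D)"
  assume good: "succ_good \<mu> ?F"
  have \<kappa>': "Card_order \<kappa>" "Field \<kappa> = UNIV" using \<kappa> card_order_on_Card_order by auto
  obtain j :: "'k set \<Rightarrow> 'b" where "inj j" "range j \<subseteq> Field \<mu>"
    using large unfolding card_of_ordLeq[symmetric] by blast
  then have j: "inj j" "\<And>A. j A \<in> Field \<mu>" by auto
  define f where "f u = {t. \<forall>A\<in>j -` u. \<forall>B\<in>j -` u. A \<noteq> B \<longrightarrow>
      A \<inter> underS \<kappa> (fst (inv b t)) \<noteq> B \<inter> underS \<kappa> (fst (inv b t))}" for u
  have sep: "eventually (\<lambda>k. A \<inter> underS \<kappa> k \<noteq> B \<inter> underS \<kappa> k) E" if "A \<noteq> B" for A B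
  proof -
    obtain x where "x \<in> A \<longleftrightarrow> x \<notin> B" using \<open>A \<noteq> B\<close> by blast
    then show ?thesis
      using measurable_final_segment[OF \<kappa> E, of x] by (auto elim!: eventually_mono)
  qed
  have "f u \<in> filter_sets ?F" if "u \<in> Fpow (Field \<mu>)" for u
  proof -
    have fin: "finite (j -` u)" using that j(1) by (auto simp: Fpow_def intro: finite_vimageI)
    have "eventually (\<lambda>k. A \<noteq> B \<longrightarrow> A \<inter> underS \<kappa> k \<noteq> B \<inter> underS \<kappa> k) E" for A B
      using sep[of A B] by (cases "A = B") auto
    then have "eventually (\<lambda>k. \<forall>A\<in>j -` u. \<forall>B\<in>j -` u. A \<noteq> B \<longrightarrow> A \<inter> underS \<kappa> k \<noteq> B \<inter> underS \<kappa> k) E"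
      by (intro eventually_ball_finite fin ballI) simp
    then show ?thesis
      unfolding filter_sets_def f_def mem_Collect_eq eventually_filtermap eventually_fubini_product inv_f_f[OF b] fst_conv
      by eventually_elim (rule always_eventually, blast)
  qed
  then obtain g where gD: "\<And>u. u \<in> Fpow (Field \<mu>) \<Longrightarrow> g u \<in> filter_sets ?F"
    and gf: "\<And>u. u \<in> Fpow (Field \<mu>) \<Longrightarrow> g u \<subseteq> f u"
    and mult: "\<And>u v. u \<in> Fpow (Field \<mu>) \<Longrightarrow> v \<in> Fpow (Field \<mu>) \<Longrightarrow> g u \<inter> g v = g (u \<union> v)"
    using good unfolding succ_good_def multiplicative_refinement_def by metis
  have jF: "{j A} \<in> Fpow (Field \<mu>)" "{j A} \<union> {j B} \<in> Fpow (Field \<mu>)" for A B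
    using j(2) by (auto simp: Fpow_def)
  have "\<exists>k. eventually (\<lambda>i. b (k, i) \<in> g {j A}) D" for A
  proof -
    have "eventually (\<lambda>k. eventually (\<lambda>i. b (k, i) \<in> g {j A}) D) E"
      using gD[OF jF(1)[of A]] unfolding filter_sets_def by (simp add: eventually_filtermap eventually_fubini_product)
    then show ?thesis using E(1) eventually_happens' unfolding ultrafilter_iff by blast
  qed
  then obtain \<tau> where \<tau>: "\<And>A. eventually (\<lambda>i. b (\<tau> A, i) \<in> g {j A}) D" by metis
  define \<Phi> where "\<Phi> A = (\<tau> A, A \<inter> underS \<kappa> (\<tau> A))" for A
  have "inj \<Phi>"
  proof (rule injI, rule ccontr)
    fix A B assume eq: "\<Phi> A = \<Phi> B" and "A \<noteq> B"
    define k where "k = \<tau> A"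
    have "\<tau> A = \<tau> B" "A \<inter> underS \<kappa> (\<tau> A) = B \<inter> underS \<kappa> (\<tau> B)"
      using eq unfolding \<Phi>_def by blast+
    then have k: "\<tau> A = k" "\<tau> B = k" "A \<inter> underS \<kappa> k = B \<inter> underS \<kappa> k"
      unfolding k_def by simp_all
    have "eventually (\<lambda>i. b (k, i) \<in> g {j A} \<and> b (k, i) \<in> g {j B}) D"
      using \<tau>[of A] \<tau>[of B] unfolding k by (rule eventually_conj)
    then obtain i where "b (k, i) \<in> g {j A}" "b (k, i) \<in> g {j B}"
      using D eventually_happens' by blast
    then have "b (k, i) \<in> f ({j A} \<union> {j B})"
      using mult[OF jF(1) jF(1), of A B] gf[OF jF(2), of A B] by blast
    then have "A \<inter> underS \<kappa> k \<noteq> B \<inter> underS \<kappa> k"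
      using \<open>A \<noteq> B\<close> unfolding f_def by (auto simp: inv_f_f[OF b])
    then show False using k(3) by simp
  qed
  have "range \<Phi> \<subseteq> (SIGMA k : UNIV. Pow (underS \<kappa> k))" unfolding \<Phi>_def by auto
  with \<open>inj \<Phi>\<close> have "|UNIV :: 'k set set| \<le>o |SIGMA k : (UNIV :: 'k set). Pow (underS \<kappa> k)|"
    using card_of_ordLeq by blast
  moreover have "|SIGMA k : (UNIV :: 'k set). Pow (underS \<kappa> k)| \<le>o |UNIV :: 'k set|"
  proof (rule card_of_Sigma_ordLeq_infinite)
    have "natLeq \<le>o |UNIV :: 'k set|"
      using ordLess_imp_ordLeq[OF unc] card_of_unique[OF \<kappa>] ordLeq_ordIso_trans by blast
    then show "infinite (UNIV :: 'k set)"
      using infinite_iff_natLeq_ordLeq by blast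
    show "\<forall>k\<in>UNIV. |Pow (underS \<kappa> k)| \<le>o |UNIV :: 'k set|"
      using measurable_strong_limit[OF E] card_of_underS[OF \<kappa>'(1)] \<kappa>'(2) by blast
  qed (rule ordIso_imp_ordLeq[OF card_of_refl])
  ultimately have "|Pow (UNIV :: 'k set)| \<le>o |UNIV :: 'k set|"
    using ordLeq_transitive by auto
  then show False using card_of_Pow not_ordLess_ordLeq by blast
qed

section \<open>Flexible ultrafilters that are not good\<close>

theorem corollary1p11:
  fixes \<kappa> :: "'k rel" and \<mu>1 :: "'m1 rel" and \<mu>2 :: "'m2 rel" and l :: "'l rel"
  assumes "card_order \<kappa>" and "Card_order \<mu>1" and "Card_order \<mu>2" and "card_order l"
    and "natLeq <o \<kappa>" and "\<kappa> <o ctwo ^c \<kappa>" and "ctwo ^c \<kappa> \<le>o \<mu>1" and "\<mu>1 \<le>o \<mu>2"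
    and "\<mu>2 <o l" and "l =o l ^c \<kappa>"
    and "measurable_cardinal \<kappa>"
  shows "\<exists>D :: 'l filter. ultrafilter D \<and> regular_filter D \<and> uniform_filter D \<and>
           flexible l D \<and> OK l D \<and> \<not> succ_good (ctwo ^c \<kappa>) D \<and>
           OK (cardSuc \<mu>2) D \<and> \<not> succ_good \<mu>1 D"
proof -
  obtain E :: "'k filter" where E: "ultrafilter E" "\<nexists>A. E = principal A" "complete_filter \<kappa> E"
    using assms(11) unfolding measurable_cardinal_def by blast
  have Fields: "Field \<kappa> = UNIV" "Field l = UNIV"
    using assms(1,4) card_order_on_Card_order by auto
  have l: "Card_order l" using card_order_on_Card_order[OF assms(4)] by blast
  have suc: "cardSuc \<mu>2 \<le>o l"
    using assms(9) cardSuc_ordLess_ordLeq[OF assms(3) l] by simp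
  have "\<mu>2 \<le>o cardSuc \<mu>2" using assms(3) by (rule cardSuc_ordLeq)
  then have \<kappa>suc: "\<kappa> \<le>o cardSuc \<mu>2"
    using ordLeq_transitive[OF ordLeq_transitive[OF ordLeq_transitive[OF ordLess_imp_ordLeq[OF assms(6)] assms(7)] assms(8)]]
    by blast
  have infinite_Field: "infinite (Field r)" if "\<kappa> \<le>o r" for r :: "'z rel"
  proof -
    have "natLeq \<le>o r" using ordLess_imp_ordLeq[OF assms(5)] that by (rule ordLeq_transitive)
    from card_of_mono2[OF this] show ?thesis by (simp add: Field_natLeq infinite_iff_card_of_nat)
  qed
  have "\<kappa> \<le>o l" using \<kappa>suc suc by (rule ordLeq_transitive)
  then have inf: "infinite (UNIV :: 'l set)" using infinite_Field[of l] Fields by simp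
  have "|UNIV :: 'k set| \<le>o |UNIV :: 'l set|" using card_of_mono2[OF \<open>\<kappa> \<le>o l\<close>] Fields by simp
  then have "|UNIV \<times> UNIV :: ('k \<times> 'l) set| =o |UNIV :: 'l set|"
    using card_of_Times_infinite[OF inf, of "UNIV :: 'k set"] by simp
  then obtain b :: "'k \<times> 'l \<Rightarrow> 'l" where b: "inj b"
    unfolding card_of_ordIso[symmetric] by (auto simp: bij_betw_def)
  obtain D1 :: "'l filter" where D1: "ultrafilter D1" "regular_filter D1" "flexible |UNIV :: 'l set| D1"
    using regular_flexible_ultrafilter_exists[OF inf] by blast
  define D where "D = filtermap b (fubini_product E D1)"
  have ultra: "ultrafilter D"
    unfolding D_def by (rule ultrafilter_filtermap_fubini_product[OF E(1) D1(1)])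
  have reg: "regular_filter D"
    unfolding D_def by (rule regular_filtermap_fubini_product[OF b D1(2)])
  have flex: "flexible r D" if "r \<le>o l" for r :: "'z rel"
    unfolding D_def
  proof (rule flexible_filtermap_fubini_product[OF b _ E(3) assms(5)])
    show "flexible r D1" using D1(3)
      by (rule flexible_mono) (use card_of_mono2[OF that] Fields in \<open>simp add: Field_card_of\<close>)
  qed
  have bad: "\<not> succ_good r D" if "ctwo ^c \<kappa> \<le>o r" for r :: "'z rel"
    unfolding D_def
  proof (rule not_succ_good_filtermap_fubini_product[OF assms(1,5) E _ b])
    show "D1 \<noteq> bot" using D1(1) unfolding ultrafilter_def by blast
    have "inj (\<lambda>A (x::'k). x \<in> A)" by (rule injI) (auto simp: fun_eq_iff)
    then have "|UNIV :: 'k set set| \<le>o |UNIV :: ('k \<Rightarrow> bool) set|"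
      using card_of_ordLeq by blast
    moreover have "Field (ctwo ^c \<kappa>) = UNIV"
      unfolding cexp_def ctwo_def by (simp add: Field_card_of Fields Func_def)
    ultimately show "|UNIV :: 'k set set| \<le>o |Field r|"
      using card_of_mono2[OF that] ordLeq_transitive by metis
  qed
  have "l \<le>o l" using l unfolding card_order_on_def by (simp add: ordLeq_reflexive)
  have "ctwo ^c \<kappa> \<le>o ctwo ^c \<kappa>" using Card_order_cexp[of ctwo \<kappa>] unfolding card_order_on_def by (simp add: ordLeq_reflexive)
  have "uniform_filter D"
    using regular_imp_uniform[OF reg _ inf] ultra unfolding ultrafilter_def by blast
  moreover have "OK l D"
    using flexible_imp_OK[OF flex reg inf] \<open>l \<le>o l\<close> infinite_Field[OF \<open>\<kappa> \<le>o l\<close>] by blast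
  moreover have "OK (cardSuc \<mu>2) D"
    using flexible_imp_OK[OF flex reg inf] suc infinite_Field[OF \<kappa>suc] by blast
  ultimately show ?thesis
    using ultra reg flex[OF \<open>l \<le>o l\<close>] bad[OF \<open>ctwo ^c \<kappa> \<le>o ctwo ^c \<kappa>\<close>] bad[OF assms(7)] by blast
qed

end
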